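(* Let $(V_i, v_i, \varphi^{(i)})_{i\in I}$ be a fusion frame system for $\mathcal{H}$, let $A\le B$ denote common frame bounds of the local frames $\varphi^{(i)}$, and let $v\varphi = (v_i\varphi_{ij})_{i\in I, j\in J_i}$ be the corresponding global frame. Then the following are equivalent: (i) $v\varphi$ is a Riesz basis (for $\mathcal{H}$). (ii) $(V_i, v_i)_{i\in I}$ is a fusion Riesz basis (for $\mathcal{H}$) and $\varphi^{(i)}$ is a Riesz basis (for $V_i$) for every $i\in I$. In particular, under these equivalent conditions: if $\alpha_V,\beta_V$ are fusion Riesz bounds for $V=(V_i,v_i)_{i\in I}$, then $\alpha_{v\varphi} = \alpha_V\cdot A$ and $\beta_{v\varphi} = \beta_V\cdot B$ are Riesz bounds for $v\varphi$; conversely, if $\alpha_{v\varphi},\beta_{v\varphi}$ are Riesz bounds for $v\varphi$, then $\alpha_V = \alpha_{v\varphi}/B$ and $\beta_V = \beta_{v\varphi}/A$ are fusion Riesz bounds for $V$.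
   Context: $\mathcal{H}$ is a separable Hilbert space. A frame for a Hilbert space $K$ is a countable family $(\psi_j)_{j\in J}$ in $K$ with constants $0<A\le B<\infty$ (frame bounds) such that $A\|f\|^2\le\sum_j|\langle f,\psi_j\rangle|^2\le B\|f\|^2$ for all $f\in K$. A fusion frame for $\mathcal{H}$ is a countable family $V=(V_i,v_i)_{i\in I}$ of closed subspaces $V_i\subseteq\mathcal{H}$ with weights $v_i>0$ for which there are constants $0<A_V\le B_V<\infty$ with $A_V\|f\|^2\le\sum_{i\in I} v_i^2\|\pi_{V_i}f\|^2\le B_V\|f\|^2$ for all $f\in\mathcal{H}$, where $\pi_{V_i}$ is the orthogonal projection onto $V_i$. A fusion frame system $(V_i,v_i,\varphi^{(i)})_{i\in I}$ for $\mathcal{H}$ consists of a fusion frame $(V_i,v_i)_{i\in I}$ for $\mathcal{H}$ and, for every $i\in I$, a frame $\varphi^{(i)}=(\varphi_{ij})_{j\in J_i}$ for $V_i$ (local frame), such that the local frames have common frame bounds $0<A\le B<\infty$. Its global frame is the family $v\varphi=(v_i\varphi_{ij})_{i\in I,j\in J_i}$ in $\mathcal{H}$. A family $(\psi_j)_{j\in J}$ in a Hilbert space $K$ is a Riesz basis for $K$ if its closed linear span is $K$ and there are constants $0<\alpha\le\beta<\infty$ (lower and upper Riesz bounds) such that $\alpha\sum|c_j|^2\le\|\sum c_j\psi_j\|^2\le\beta\sum|c_j|^2$ for every finite scalar sequence $(c_j)$. A family $(V_i,v_i)_{i\in I}$ of closed subspaces with weights $v_i>0$ is a fusion Riesz basis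 for $\mathcal{H}$ if the closed linear span of $\bigcup_i V_i$ is $\mathcal{H}$ and there are constants $0<\alpha_V\le\beta_V<\infty$ (lower and upper fusion Riesz bounds) such that for every finite $J\subseteq I$ and all $f_j\in V_j$ ($j\in J$): $\alpha_V\sum_{j\in J}\|f_j\|^2\le\|\sum_{j\in J}v_jf_j\|^2\le\beta_V\sum_{j\in J}\|f_j\|^2$. *)

theory Defs
  imports "HOL-Analysis.Analysis"
begin

section \<open>Separable Hilbert spaces over the real or the complex numbers\<close>

text \<open>
  The library only has inner product spaces over the reals. The following class treats both
  scalar fields at once. A (commutative) real normed field is isometrically isomorphic to the
  real or the complex numbers (Gelfand--Mazur), and the second axiom then leaves no choice
  but the identity and complex conjugation, respectively.
\<close>

class rc_field = real_normed_field + complete_space +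
  fixes conjugate :: "'a \<Rightarrow> 'a"
  assumes conjugate_add: "conjugate (x + y) = conjugate x + conjugate y"
    and mult_conjugate: "x * conjugate x = (norm x)\<^sup>2 *\<^sub>R 1"

instantiation real :: rc_field
begin

definition conjugate_real :: "real \<Rightarrow> real" where
  "conjugate_real x = x"

instance
  by standard (simp_all add: conjugate_real_def power2_eq_square)

end

instantiation complex :: rc_field
begin

definition conjugate_complex :: "complex \<Rightarrow> complex" where
  "conjugate_complex = cnj"

instance
  by standard
    (simp_all add: conjugate_complex_def complex_norm_square scaleR_conv_of_real del: of_real_power)

end

text \<open>
  The type class \<^class>\<open>banach\<close> provides the norm, the topology and completeness. The norm is
  the one induced by the inner product, which is linear in its first argument.
\<close>

locale hilbert_space = vector_space smul
  for smul :: "'k::rc_field \<Rightarrow> 'a::banach \<Rightarrow> 'a" +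
  fixes ip :: "'a \<Rightarrow> 'a \<Rightarrow> 'k"
  assumes smul_of_real: "smul (of_real r) x = r *\<^sub>R x"
    and ip_add_left: "ip (x + y) z = ip x z + ip y z"
    and ip_smul_left: "ip (smul c x) y = c * ip x y"
    and ip_conjugate: "ip y x = conjugate (ip x y)"
    and ip_self: "ip x x = of_real ((norm x)\<^sup>2)"
    and separable: "\<exists>D :: 'a set. countable D \<and> closure D = UNIV"

lemma hilbert_space_real:
  assumes "\<exists>D :: 'a::{real_inner, banach} set. countable D \<and> closure D = UNIV"
  shows "hilbert_space scaleR ((\<bullet>) :: 'a \<Rightarrow> 'a \<Rightarrow> real)"
proof
  show "\<exists>D :: 'a set. countable D \<and> closure D = UNIV"
    by (rule assms)
  fix r c :: real and x y z :: 'a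
  show "of_real r *\<^sub>R x = r *\<^sub>R x" by simp
  show "(x + y) \<bullet> z = x \<bullet> z + y \<bullet> z" by (rule inner_add_left)
  show "(c *\<^sub>R x) \<bullet> y = c * (x \<bullet> y)" by simp
  show "y \<bullet> x = conjugate (x \<bullet> y)" by (simp add: conjugate_real_def inner_commute)
  show "x \<bullet> x = of_real ((norm x)\<^sup>2)" by (simp add: power2_norm_eq_inner)
qed

lemma hilbert_space_complex:
  "hilbert_space (*) (\<lambda>x y :: complex. x * cnj y)"
proof
  obtain D :: "complex set" where D: "countable D" "UNIV \<subseteq> closure D"
    by (rule separable)
  then show "\<exists>D :: complex set. countable D \<and> closure D = UNIV"
    by (auto intro!: exI[of _ D])
  fix r :: real and c x y z :: complex
  show "of_real r * x = r *\<^sub>R x" by (simp add: scaleR_conv_of_real)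
  show "(x + y) * cnj z = x * cnj z + y * cnj z" by (rule distrib_right)
  show "c * x * cnj y = c * (x * cnj y)" by (rule mult.assoc)
  show "y * cnj x = conjugate (x * cnj y)" by (simp add: conjugate_complex_def)
  show "x * cnj x = of_real ((norm x)\<^sup>2)" by (rule complex_norm_square[symmetric])
qed

text \<open>
  For a closed subspace \<open>V\<close> of a Hilbert space, the orthogonal projection of \<open>f\<close> is the unique
  \<open>p \<in> V\<close> such that \<open>f - p\<close> is orthogonal to \<open>V\<close>.
\<close>

definition orth_proj :: "('a::banach \<Rightarrow> 'a \<Rightarrow> 'k::rc_field) \<Rightarrow> 'a set \<Rightarrow> 'a \<Rightarrow> 'a" where
  "orth_proj ip V f = (THE p. p \<in> V \<and> (\<forall>g\<in>V. ip (f - p) g = 0))"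


section \<open>Frames and Riesz bases\<close>

text \<open>
  Families are functions restricted to an index set. The Hilbert space \<open>K\<close> is a closed subspace
  of the ambient space, which is the case \<open>K = UNIV\<close>.
\<close>

definition frame_bounds ::
  "('a::banach \<Rightarrow> 'a \<Rightarrow> 'k::rc_field) \<Rightarrow> 'a set \<Rightarrow> 'j set \<Rightarrow> ('j \<Rightarrow> 'a) \<Rightarrow> real \<Rightarrow> real \<Rightarrow> bool" where
  "frame_bounds ip K J \<psi> A B \<longleftrightarrow> 0 < A \<and> A \<le> B \<and>
     (\<forall>f\<in>K. (\<lambda>j. (norm (ip f (\<psi> j)))\<^sup>2) summable_on J \<and>
            A * (norm f)\<^sup>2 \<le> (\<Sum>\<^sub>\<infinity>j\<in>J. (norm (ip f (\<psi> j)))\<^sup>2) \<and>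
            (\<Sum>\<^sub>\<infinity>j\<in>J. (norm (ip f (\<psi> j)))\<^sup>2) \<le> B * (norm f)\<^sup>2)"

definition frame ::
  "('a::banach \<Rightarrow> 'a \<Rightarrow> 'k::rc_field) \<Rightarrow> 'a set \<Rightarrow> 'j set \<Rightarrow> ('j \<Rightarrow> 'a) \<Rightarrow> bool" where
  "frame ip K J \<psi> \<longleftrightarrow> countable J \<and> (\<forall>j\<in>J. \<psi> j \<in> K) \<and> (\<exists>A B. frame_bounds ip K J \<psi> A B)"

definition riesz_bounds ::
  "('k::rc_field \<Rightarrow> 'a::banach \<Rightarrow> 'a) \<Rightarrow> 'j set \<Rightarrow> ('j \<Rightarrow> 'a) \<Rightarrow> real \<Rightarrow> real \<Rightarrow> bool" where
  "riesz_bounds smul J \<psi> \<alpha> \<beta> \<longleftrightarrow> 0 < \<alpha> \<and> \<alpha> \<le> \<beta> \<and>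
     (\<forall>F c. finite F \<and> F \<subseteq> J \<longrightarrow>
        \<alpha> * (\<Sum>j\<in>F. (norm (c j))\<^sup>2) \<le> (norm (\<Sum>j\<in>F. smul (c j) (\<psi> j)))\<^sup>2 \<and>
        (norm (\<Sum>j\<in>F. smul (c j) (\<psi> j)))\<^sup>2 \<le> \<beta> * (\<Sum>j\<in>F. (norm (c j))\<^sup>2))"

definition riesz_basis ::
  "('k::rc_field \<Rightarrow> 'a::banach \<Rightarrow> 'a) \<Rightarrow> 'a set \<Rightarrow> 'j set \<Rightarrow> ('j \<Rightarrow> 'a) \<Rightarrow> bool" where
  "riesz_basis smul K J \<psi> \<longleftrightarrow>
     closure (module.span smul (\<psi> ` J)) = K \<and> (\<exists>\<alpha> \<beta>. riesz_bounds smul J \<psi> \<alpha> \<beta>)"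


section \<open>Fusion frames, fusion Riesz bases and fusion frame systems\<close>

definition weighted_subspaces ::
  "('k::rc_field \<Rightarrow> 'a::banach \<Rightarrow> 'a) \<Rightarrow> 'i set \<Rightarrow> ('i \<Rightarrow> 'a set) \<Rightarrow> ('i \<Rightarrow> real) \<Rightarrow> bool" where
  "weighted_subspaces smul I V v \<longleftrightarrow>
     (\<forall>i\<in>I. module.subspace smul (V i) \<and> closed (V i) \<and> 0 < v i)"

definition fusion_frame_bounds ::
  "('a::banach \<Rightarrow> 'a \<Rightarrow> 'k::rc_field) \<Rightarrow> 'i set \<Rightarrow> ('i \<Rightarrow> 'a set) \<Rightarrow> ('i \<Rightarrow> real) \<Rightarrow>
     real \<Rightarrow> real \<Rightarrow> bool" where
  "fusion_frame_bounds ip I V v A B \<longleftrightarrow> 0 < A \<and> A \<le> B \<and>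
     (\<forall>f. (\<lambda>i. (v i)\<^sup>2 * (norm (orth_proj ip (V i) f))\<^sup>2) summable_on I \<and>
          A * (norm f)\<^sup>2 \<le> (\<Sum>\<^sub>\<infinity>i\<in>I. (v i)\<^sup>2 * (norm (orth_proj ip (V i) f))\<^sup>2) \<and>
          (\<Sum>\<^sub>\<infinity>i\<in>I. (v i)\<^sup>2 * (norm (orth_proj ip (V i) f))\<^sup>2) \<le> B * (norm f)\<^sup>2)"

definition fusion_frame ::
  "('k::rc_field \<Rightarrow> 'a::banach \<Rightarrow> 'a) \<Rightarrow> ('a \<Rightarrow> 'a \<Rightarrow> 'k) \<Rightarrow>
     'i set \<Rightarrow> ('i \<Rightarrow> 'a set) \<Rightarrow> ('i \<Rightarrow> real) \<Rightarrow> bool" where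
  "fusion_frame smul ip I V v \<longleftrightarrow>
     countable I \<and> weighted_subspaces smul I V v \<and> (\<exists>A B. fusion_frame_bounds ip I V v A B)"

definition fusion_riesz_bounds ::
  "'i set \<Rightarrow> ('i \<Rightarrow> 'a::banach set) \<Rightarrow> ('i \<Rightarrow> real) \<Rightarrow> real \<Rightarrow> real \<Rightarrow> bool" where
  "fusion_riesz_bounds I V v \<alpha> \<beta> \<longleftrightarrow> 0 < \<alpha> \<and> \<alpha> \<le> \<beta> \<and>
     (\<forall>F f. finite F \<and> F \<subseteq> I \<and> (\<forall>i\<in>F. f i \<in> V i) \<longrightarrow>
        \<alpha> * (\<Sum>i\<in>F. (norm (f i))\<^sup>2) \<le> (norm (\<Sum>i\<in>F. v i *\<^sub>R f i))\<^sup>2 \<and>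
        (norm (\<Sum>i\<in>F. v i *\<^sub>R f i))\<^sup>2 \<le> \<beta> * (\<Sum>i\<in>F. (norm (f i))\<^sup>2))"

definition fusion_riesz_basis ::
  "('k::rc_field \<Rightarrow> 'a::banach \<Rightarrow> 'a) \<Rightarrow> 'i set \<Rightarrow> ('i \<Rightarrow> 'a set) \<Rightarrow> ('i \<Rightarrow> real) \<Rightarrow> bool" where
  "fusion_riesz_basis smul I V v \<longleftrightarrow>
     weighted_subspaces smul I V v \<and>
     closure (module.span smul (\<Union>i\<in>I. V i)) = UNIV \<and>
     (\<exists>\<alpha> \<beta>. fusion_riesz_bounds I V v \<alpha> \<beta>)"

text \<open>
  The explicit conditions on \<open>A\<close> and \<open>B\<close> matter only if \<open>I\<close> is empty.
\<close>

definition common_frame_bounds ::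
  "('a::banach \<Rightarrow> 'a \<Rightarrow> 'k::rc_field) \<Rightarrow> 'i set \<Rightarrow> ('i \<Rightarrow> 'a set) \<Rightarrow>
     ('i \<Rightarrow> 'j set) \<Rightarrow> ('i \<Rightarrow> 'j \<Rightarrow> 'a) \<Rightarrow> real \<Rightarrow> real \<Rightarrow> bool" where
  "common_frame_bounds ip I V J \<phi> A B \<longleftrightarrow>
     0 < A \<and> A \<le> B \<and> (\<forall>i\<in>I. frame_bounds ip (V i) (J i) (\<phi> i) A B)"

definition fusion_frame_system ::
  "('k::rc_field \<Rightarrow> 'a::banach \<Rightarrow> 'a) \<Rightarrow> ('a \<Rightarrow> 'a \<Rightarrow> 'k) \<Rightarrow>
     'i set \<Rightarrow> ('i \<Rightarrow> 'a set) \<Rightarrow> ('i \<Rightarrow> real) \<Rightarrow> ('i \<Rightarrow> 'j set) \<Rightarrow> ('i \<Rightarrow> 'j \<Rightarrow> 'a) \<Rightarrow> bool" where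
  "fusion_frame_system smul ip I V v J \<phi> \<longleftrightarrow>
     fusion_frame smul ip I V v \<and>
     (\<forall>i\<in>I. frame ip (V i) (J i) (\<phi> i)) \<and>
     (\<exists>A B. common_frame_bounds ip I V J \<phi> A B)"

text \<open>The global frame is indexed by the set \<^term>\<open>Sigma I J\<close>.\<close>

definition global_frame :: "('i \<Rightarrow> real) \<Rightarrow> ('i \<Rightarrow> 'j \<Rightarrow> 'a::banach) \<Rightarrow> 'i \<times> 'j \<Rightarrow> 'a" where
  "global_frame v \<phi> = (\<lambda>(i, j). v i *\<^sub>R \<phi> i j)"

end

theory Submission
  imports Defs
begin

text \<open>
  A frame that is a Riesz sequence has its frame bounds as Riesz bounds, so in both directions the
  local frames relate \<open>\<parallel>f\<^sub>i\<parallel>\<^sup>2\<close> to \<open>\<Sum>\<^sub>j |c\<^sub>i\<^sub>j|\<^sup>2\<close> for \<open>f\<^sub>i = \<Sum>\<^sub>j c\<^sub>i\<^sub>j \<phi>\<^sub>i\<^sub>j\<close> with the uniform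
  constants \<open>A\<close> and \<open>B\<close>. Such \<open>f\<^sub>i\<close> are dense in \<open>V\<^sub>i\<close>, because a vector of \<open>V\<^sub>i\<close> orthogonal to
  all of them vanishes by the lower frame bound.
\<close>

section \<open>Conjugation in the scalar field\<close>

lemma conjugate_0 [simp]: "conjugate (0::'k::rc_field) = 0"
  using conjugate_add[of "0::'k" 0] by simp

lemma norm_conjugate [simp]: "norm (conjugate (x::'k::rc_field)) = norm x"
proof (cases "x = 0")
  case False
  have "norm x * norm (conjugate x) = norm x * norm x"
    by (simp add: mult_conjugate power2_eq_square flip: norm_mult)
  then show ?thesis using False by simp
qed simp

text \<open>The axioms give only additivity and the product of a scalar with its conjugate. Both
  candidates for the conjugate have the same product with \<open>x * y\<close>, namely its squared
  norm, so a nonzero \<open>x * y\<close> cancels.\<close>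

lemma conjugate_mult: "conjugate (x * y :: 'k::rc_field) = conjugate x * conjugate y"
proof (cases "x * y = 0")
  case True
  then show ?thesis by auto
next
  case False
  have "(x * y) * conjugate (x * y) = (x * conjugate x) * (y * conjugate y)"
    by (simp add: mult_conjugate norm_mult power_mult_distrib)
  then have "(x * y) * conjugate (x * y) = (x * y) * (conjugate x * conjugate y)"
    by (simp add: ac_simps)
  then show ?thesis using False by simp
qed

lemma mult_conjugate': "x * conjugate x = of_real ((norm (x::'k::rc_field))\<^sup>2)"
  by (simp add: mult_conjugate scaleR_conv_of_real)

lemma riesz_boundsD:
  assumes "riesz_bounds smul J \<psi> \<alpha> \<beta>" "finite F" "F \<subseteq> J"
  shows "\<alpha> * (\<Sum>j\<in>F. (norm (c j))\<^sup>2) \<le> (norm (\<Sum>j\<in>F. smul (c j) (\<psi> j)))\<^sup>2"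
    and "(norm (\<Sum>j\<in>F. smul (c j) (\<psi> j)))\<^sup>2 \<le> \<beta> * (\<Sum>j\<in>F. (norm (c j))\<^sup>2)"
  using assms unfolding riesz_bounds_def by blast+

section \<open>Calculus of the inner product and its norm\<close>

context hilbert_space
begin

lemma ip_add_right: "ip x (y + z) = ip x y + ip x z"
  by (metis ip_add_left ip_conjugate conjugate_add)

lemma ip_smul_right: "ip x (smul c y) = conjugate c * ip x y"
  by (metis ip_smul_left ip_conjugate conjugate_mult)

lemma ip_zero_left [simp]: "ip 0 y = 0"
  using ip_add_left[of 0 0 y] by simp

lemma ip_zero_right [simp]: "ip x 0 = 0"
  using ip_add_right[of x 0 0] by simp

lemma ip_minus_left [simp]: "ip (- x) y = - ip x y"
  using ip_add_left[of x "- x" y] by (simp add: eq_neg_iff_add_eq_0 add.commute)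

lemma ip_minus_right [simp]: "ip x (- y) = - ip x y"
  using ip_add_right[of x y "- y"] by (simp add: eq_neg_iff_add_eq_0 add.commute)

lemma ip_diff_left: "ip (x - y) z = ip x z - ip y z"
  using ip_add_left[of x "- y" z] by simp

lemma ip_diff_right: "ip x (y - z) = ip x y - ip x z"
  using ip_add_right[of x y "- z"] by simp

lemma ip_sum_left: "ip (\<Sum>i\<in>F. f i) y = (\<Sum>i\<in>F. ip (f i) y)"
  by (induction F rule: infinite_finite_induct) (auto simp: ip_add_left)

lemma ip_sum_right: "ip x (\<Sum>i\<in>F. f i) = (\<Sum>i\<in>F. ip x (f i))"
  by (induction F rule: infinite_finite_induct) (auto simp: ip_add_right)

lemma norm_ip_commute: "norm (ip x y) = norm (ip y x)"
  by (metis ip_conjugate norm_conjugate)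

lemma norm_smul: "norm (smul c x) = norm c * norm x"
proof -
  have "of_real ((norm (smul c x))\<^sup>2) = (c * conjugate c) * ip x x"
    unfolding ip_self[symmetric] by (simp add: ip_smul_left ip_smul_right)
  also have "\<dots> = (of_real ((norm c * norm x)\<^sup>2) :: 'k)"
    by (simp only: mult_conjugate' ip_self flip: of_real_mult power_mult_distrib)
  finally show ?thesis
    by (simp only: of_real_eq_iff) (simp add: power2_eq_iff_nonneg)
qed

text \<open>Pythagoras for the residual of \<open>x\<close> after projection onto the line of
  \<open>y\<close>. Nonnegativity of the left side yields Cauchy-Schwarz; minimality of a distance
  will yield orthogonality to \<open>y\<close>.\<close>

lemma norm_diff_proj_line:
  assumes "y \<noteq> 0"
  shows "(norm (x - smul (ip x y / of_real ((norm y)\<^sup>2)) y))\<^sup>2 =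
           (norm x)\<^sup>2 - (norm (ip x y))\<^sup>2 / (norm y)\<^sup>2"
proof -
  define c where "c = ip x y / of_real ((norm y)\<^sup>2)"
  have y0: "(of_real ((norm y)\<^sup>2) :: 'k) \<noteq> 0" using assms by simp
  have cy: "c * ip y y = ip x y"
    using y0 by (simp add: c_def ip_self)
  have ort: "ip (x - smul c y) y = 0"
    by (simp add: ip_diff_left ip_smul_left cy)
  have "of_real ((norm (x - smul c y))\<^sup>2) = ip (x - smul c y) x"
    unfolding ip_self[symmetric] ip_diff_right[of _ x] by (simp add: ip_smul_right ort)
  also have "\<dots> = ip x x - c * conjugate (ip x y)"
    by (simp add: ip_diff_left ip_smul_left ip_conjugate[of y x])
  also have "c * conjugate (ip x y) = of_real ((norm (ip x y))\<^sup>2) / of_real ((norm y)\<^sup>2)"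
    by (simp add: c_def mult_conjugate' del: of_real_power)
  also have "ip x x - \<dots> = of_real ((norm x)\<^sup>2 - (norm (ip x y))\<^sup>2 / (norm y)\<^sup>2)"
    by (simp add: ip_self)
  finally show ?thesis by (simp only: of_real_eq_iff c_def)
qed

lemma Cauchy_Schwarz_ip: "norm (ip x y) \<le> norm x * norm y"
proof (cases "y = 0")
  case False
  have "0 \<le> (norm x)\<^sup>2 - (norm (ip x y))\<^sup>2 / (norm y)\<^sup>2"
    using norm_diff_proj_line[OF False, of x] by (metis zero_le_power2)
  then have "(norm (ip x y))\<^sup>2 \<le> (norm x * norm y)\<^sup>2"
    using False by (simp add: field_simps power_mult_distrib)
  then show ?thesis by (rule power2_le_imp_le) simp
qed simp

lemma parallelogram:
  fixes x y :: 'a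
  shows "(norm (x + y))\<^sup>2 + (norm (x - y))\<^sup>2 = 2 * (norm x)\<^sup>2 + 2 * (norm y)\<^sup>2"
proof -
  have "ip (x + y) (x + y) + ip (x - y) (x - y) = 2 * ip x x + 2 * ip y y"
    by (simp add: ip_add_left ip_add_right ip_diff_left ip_diff_right algebra_simps)
  then have "(of_real ((norm (x + y))\<^sup>2 + (norm (x - y))\<^sup>2) :: 'k) =
      of_real (2 * (norm x)\<^sup>2 + 2 * (norm y)\<^sup>2)"
    by (simp add: ip_self)
  then show ?thesis by (simp only: of_real_eq_iff)
qed

section \<open>Closed subspaces and orthogonal projection\<close>

lemma smul_scaleR: "smul c (r *\<^sub>R x) = r *\<^sub>R smul c x"
  by (simp add: mult.commute flip: smul_of_real)

lemma bounded_linear_smul: "bounded_linear (smul c)"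
proof (rule bounded_linear_intro[where K = "norm c"])
qed (simp_all add: smul_scaleR scale_right_distrib norm_smul mult.commute)

lemma subspace_scaleR: "subspace W \<Longrightarrow> x \<in> W \<Longrightarrow> r *\<^sub>R x \<in> W"
  by (metis smul_of_real subspace_scale)

lemma subspace_closure:
  assumes "subspace W"
  shows "subspace (closure W)"
proof (rule subspaceI)
  show "0 \<in> closure W"
    using subspace_0[OF assms] closure_subset by blast
next
  fix x y assume "x \<in> closure W" "y \<in> closure W"
  then obtain s t where "\<forall>n. s n \<in> W" "s \<longlonglongrightarrow> x" "\<forall>n. t n \<in> W" "t \<longlonglongrightarrow> y"
    unfolding closure_sequential by blast
  then have "\<forall>n. s n + t n \<in> W" "(\<lambda>n. s n + t n) \<longlonglongrightarrow> x + y"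
    using subspace_add[OF assms] by (auto intro: tendsto_add)
  then show "x + y \<in> closure W"
    unfolding closure_sequential by (auto intro!: exI[of _ "\<lambda>n. s n + t n"])
next
  fix c x assume "x \<in> closure W"
  then obtain s where "\<forall>n. s n \<in> W" "s \<longlonglongrightarrow> x"
    unfolding closure_sequential by blast
  then have "\<forall>n. smul c (s n) \<in> W" "(\<lambda>n. smul c (s n)) \<longlonglongrightarrow> smul c x"
    using subspace_scale[OF assms] bounded_linear.tendsto[OF bounded_linear_smul] by auto
  then show "smul c x \<in> closure W"
    unfolding closure_sequential by (auto intro!: exI[of _ "\<lambda>n. smul c (s n)"])
qed

text \<open>A sequence in \<open>W\<close> minimising the distance to \<open>f\<close> is Cauchy by
  the parallelogram law. Its limit \<open>p\<close> attains the distance, and moving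
  \<open>p\<close> along \<open>g\<close> would shorten \<open>f - p\<close> unless the two were
  orthogonal.\<close>

lemma orthogonal_decomposition:
  assumes W: "subspace W" and cl: "closed W"
  obtains p where "p \<in> W" "\<And>g. g \<in> W \<Longrightarrow> ip (f - p) g = 0"
proof -
  have ne: "W \<noteq> {}" using subspace_0[OF W] by blast
  define d where "d = infdist f W"
  have d0: "d \<ge> 0" by (simp add: d_def infdist_nonneg)
  have d_le: "d \<le> norm (f - w)" if "w \<in> W" for w
    using infdist_le[OF that, of f] by (simp add: d_def dist_norm)
  have "\<exists>w\<in>W. (norm (f - w))\<^sup>2 < d\<^sup>2 + e" if "e > 0" for e
  proof -
    have "d < sqrt (d\<^sup>2 + e)" using that by (simp add: real_less_rsqrt)
    then obtain w where w: "w \<in> W" "norm (f - w) < sqrt (d\<^sup>2 + e)"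
      using ne cInf_lessD[of "(\<lambda>a. dist f a) ` W"] unfolding d_def infdist_notempty[OF ne]
      by (auto simp: dist_norm)
    have "(norm (f - w))\<^sup>2 < (sqrt (d\<^sup>2 + e))\<^sup>2"
      using w by (intro power_strict_mono) auto
    then show ?thesis using w that by auto
  qed
  then have "\<forall>n. \<exists>w\<in>W. (norm (f - w))\<^sup>2 < d\<^sup>2 + inverse (real (Suc n))"
    by simp
  then obtain w where wW: "\<And>n. w n \<in> W"
    and wd: "\<And>n. (norm (f - w n))\<^sup>2 < d\<^sup>2 + inverse (real (Suc n))"
    by metis
  \<comment> \<open>The midpoint of \<open>w m\<close> and \<open>w n\<close> lies in
    \<open>W\<close>, so its distance to \<open>f\<close> is at least \<open>d\<close>; the
    parallelogram law turns the two nearly minimal distances into a bound on the gap.\<close>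
  have close: "(norm (w m - w n))\<^sup>2 \<le> 2 * inverse (real (Suc m)) + 2 * inverse (real (Suc n))" for m n
  proof -
    have "(1/2) *\<^sub>R (w m + w n) \<in> W"
      by (intro subspace_scaleR subspace_add W wW)
    from d_le[OF this] have "d\<^sup>2 \<le> (norm (f - (1/2) *\<^sub>R (w m + w n)))\<^sup>2"
      using d0 by (rule power_mono)
    also have "f - (1/2) *\<^sub>R (w m + w n) = (1/2) *\<^sub>R ((f - w m) + (f - w n))"
      by (simp add: algebra_simps flip: scaleR_2)
    also have "(norm \<dots>)\<^sup>2 = (norm ((f - w m) + (f - w n)))\<^sup>2 / 4"
      by (simp add: power_divide)
    finally have "4 * d\<^sup>2 \<le> (norm ((f - w m) + (f - w n)))\<^sup>2" by simp
    moreover have "norm ((f - w m) - (f - w n)) = norm (w m - w n)"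
      by (simp add: norm_minus_commute)
    ultimately show ?thesis
      using parallelogram[of "f - w m" "f - w n"] wd[of m] wd[of n] by simp
  qed
  have "Cauchy w"
  proof (rule metric_CauchyI)
    fix e :: real assume "e > 0"
    \<comment> \<open>Beyond \<open>N\<close> the squared gap is at most
      \<open>4 * inverse (real (Suc N))\<close> by \<open>close\<close>, hence the divisor
      4.\<close>
    then obtain N where N: "inverse (real (Suc N)) < e\<^sup>2 / 4"
      using reals_Archimedean[of "e\<^sup>2 / 4"] by auto
    have "dist (w m) (w n) < e" if "m \<ge> N" "n \<ge> N" for m n
    proof -
      have "inverse (real (Suc m)) \<le> inverse (real (Suc N))"
        "inverse (real (Suc n)) \<le> inverse (real (Suc N))"
        using that by (auto intro!: le_imp_inverse_le)
      then have "(norm (w m - w n))\<^sup>2 < e\<^sup>2" using close[of m n] N by linarith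
      then show ?thesis
        using \<open>e > 0\<close> by (simp add: dist_norm power_less_imp_less_base)
    qed
    then show "\<exists>N. \<forall>m\<ge>N. \<forall>n\<ge>N. dist (w m) (w n) < e" by blast
  qed
  then obtain p where p: "w \<longlonglongrightarrow> p"
    using Cauchy_convergent convergent_def by blast
  have pW: "p \<in> W"
    using closed_sequentially[OF cl wW p] .
  have "(\<lambda>n. d\<^sup>2 + inverse (real (Suc n))) \<longlonglongrightarrow> d\<^sup>2 + 0"
    by (intro tendsto_intros LIMSEQ_inverse_real_of_nat)
  moreover have "(\<lambda>n. (norm (f - w n))\<^sup>2) \<longlonglongrightarrow> (norm (f - p))\<^sup>2"
    by (intro tendsto_intros p)
  ultimately have "(norm (f - p))\<^sup>2 \<le> d\<^sup>2 + 0"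
    using wd less_imp_le by (intro LIMSEQ_le) blast+
  then have pd: "(norm (f - p))\<^sup>2 \<le> d\<^sup>2" by simp
  have "ip (f - p) g = 0" if g: "g \<in> W" for g
  proof (cases "g = 0")
    case False
    \<comment> \<open>\<open>smul c g\<close> is the projection of \<open>f - p\<close> onto the
      line of \<open>g\<close>, so it is the best move of \<open>p\<close> in that
      direction.\<close>
    define c where "c = ip (f - p) g / of_real ((norm g)\<^sup>2)"
    have "p + smul c g \<in> W" by (intro subspace_add subspace_scale W pW g)
    from d_le[OF this] have "d\<^sup>2 \<le> (norm (f - p - smul c g))\<^sup>2"
      using d0 power_mono[of d] by (simp add: diff_diff_eq)
    also have "\<dots> = (norm (f - p))\<^sup>2 - (norm (ip (f - p) g))\<^sup>2 / (norm g)\<^sup>2"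
      unfolding c_def by (rule norm_diff_proj_line[OF False])
    finally have "(norm (ip (f - p) g))\<^sup>2 / (norm g)\<^sup>2 \<le> 0" using pd by linarith
    then show ?thesis using False by (simp add: divide_le_0_iff)
  qed simp
  then show thesis using that pW by blast
qed

section \<open>Finite combinations, dense spans and biorthogonal vectors\<close>

lemma span_image_explicit:
  assumes "x \<in> span (\<psi> ` J)"
  obtains F c where "finite F" "F \<subseteq> J" "x = (\<Sum>j\<in>F. smul (c j) (\<psi> j))"
proof -
  from assms obtain t r where t: "finite t" "t \<subseteq> \<psi> ` J" "x = (\<Sum>a\<in>t. smul (r a) a)"
    unfolding span_explicit by blast
  \<comment> \<open>\<open>\<psi>\<close> may repeat values, so one index is picked for each vector
    of \<open>t\<close>.\<close>
  from t obtain F where F: "F \<subseteq> J" "inj_on \<psi> F" "t = \<psi> ` F"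
    by (meson subset_image_inj)
  then have "finite F" using t finite_image_iff by blast
  moreover have "x = (\<Sum>j\<in>F. smul ((r \<circ> \<psi>) j) (\<psi> j))"
    using t F by (simp add: sum.reindex)
  ultimately show thesis using that F by blast
qed

lemma closure_span_subset:
  assumes "subspace V" "closed V" "S \<subseteq> V"
  shows "closure (span S) \<subseteq> V"
  using assms by (intro closure_minimal span_minimal)

lemma frame_span_dense:
  assumes V: "subspace V" "closed V" and \<psi>: "\<And>j. j \<in> J \<Longrightarrow> \<psi> j \<in> V"
    and fb: "frame_bounds ip V J \<psi> A B"
  shows "closure (span (\<psi> ` J)) = V"
proof
  show sub: "closure (span (\<psi> ` J)) \<subseteq> V"
    using V \<psi> by (intro closure_span_subset) auto
  show "V \<subseteq> closure (span (\<psi> ` J))"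
  proof
    fix f assume f: "f \<in> V"
    obtain p where p: "p \<in> closure (span (\<psi> ` J))"
      and o: "\<And>g. g \<in> closure (span (\<psi> ` J)) \<Longrightarrow> ip (f - p) g = 0"
      by (rule orthogonal_decomposition[of "closure (span (\<psi> ` J))" f])
        (auto intro: subspace_closure)
    have "ip (f - p) (\<psi> j) = 0" if "j \<in> J" for j
      using that by (intro o subsetD[OF closure_subset] span_base) auto
    then have "(\<Sum>\<^sub>\<infinity>j\<in>J. (norm (ip (f - p) (\<psi> j)))\<^sup>2) = 0"
      by (intro infsum_0) auto
    \<comment> \<open>The lower frame bound speaks only of vectors of \<open>V\<close>, so the
      residual has to stay in \<open>V\<close>; \<open>sub\<close> ensures this.\<close>
    moreover have "f - p \<in> V" using V f p sub by (blast intro: subspace_diff)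
    ultimately have "A * (norm (f - p))\<^sup>2 \<le> 0" "A > 0"
      using fb unfolding frame_bounds_def by force+
    then have "f = p" by (simp add: mult_le_0_iff)
    then show "f \<in> closure (span (\<psi> ` J))" using p by simp
  qed
qed

text \<open>The lower Riesz bound keeps \<open>\<psi> j\<close> away from the closed span of the
  other vectors. Its residual after projection onto that span is therefore nonzero and orthogonal to
  all the others; it remains to normalise it.\<close>

lemma biorthogonal_vector:
  assumes V: "subspace V" "closed V" and \<psi>: "\<And>j. j \<in> J \<Longrightarrow> \<psi> j \<in> V"
    and rb: "riesz_bounds smul J \<psi> \<alpha> \<beta>" and j: "j \<in> J"
  obtains g where "g \<in> V" "ip g (\<psi> j) = 1" "\<And>k. k \<in> J - {j} \<Longrightarrow> ip g (\<psi> k) = 0"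
proof -
  define W where "W = closure (span (\<psi> ` (J - {j})))"
  have a0: "\<alpha> > 0" using rb by (simp add: riesz_bounds_def)
  have "subspace W" "closed W" by (auto simp: W_def intro: subspace_closure)
  then obtain p where p: "p \<in> W" and o: "\<And>g. g \<in> W \<Longrightarrow> ip (\<psi> j - p) g = 0"
    by (rule orthogonal_decomposition[of W "\<psi> j"]) blast
  have WV: "W \<subseteq> V"
    unfolding W_def using V \<psi> by (intro closure_span_subset) auto
  define r where "r = \<psi> j - p"
  have "\<alpha> \<le> (norm (\<psi> j - x))\<^sup>2" if x: "x \<in> span (\<psi> ` (J - {j}))" for x
  proof -
    obtain F c where F: "finite F" "F \<subseteq> J - {j}" "x = (\<Sum>k\<in>F. smul (c k) (\<psi> k))"
      using span_image_explicit[OF x] by blast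
    \<comment> \<open>\<open>c'\<close> is the coefficient family of \<open>\<psi> j - x\<close>;
      its entry 1 at \<open>j\<close> alone makes the lower Riesz estimate at least
      \<open>\<alpha>\<close>.\<close>
    define c' where "c' k = (if k = j then 1 else - c k)" for k
    have "(\<Sum>k\<in>insert j F. smul (c' k) (\<psi> k)) = \<psi> j + (\<Sum>k\<in>F. smul (- c k) (\<psi> k))"
      using F by (subst sum.insert) (auto simp: c'_def intro!: sum.cong)
    also have "\<dots> = \<psi> j - x" by (simp add: F sum_negf)
    finally have "\<alpha> * (\<Sum>k\<in>insert j F. (norm (c' k))\<^sup>2) \<le> (norm (\<psi> j - x))\<^sup>2"
      using rb F j unfolding riesz_bounds_def
      by (metis (no_types, lifting) Diff_subset finite_insert insert_subset subset_trans)
    moreover have "(\<Sum>k\<in>insert j F. (norm (c' k))\<^sup>2) \<ge> (norm (c' j))\<^sup>2"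
      using F by (intro member_le_sum) auto
    then have "\<alpha> * 1 \<le> \<alpha> * (\<Sum>k\<in>insert j F. (norm (c' k))\<^sup>2)"
      using a0 by (intro mult_left_mono) (auto simp: c'_def)
    ultimately show ?thesis by simp
  qed
  \<comment> \<open>Closedness carries the estimate from the span to its closure, where
    \<open>p\<close> lives.\<close>
  moreover have "closed {x. \<alpha> \<le> (norm (\<psi> j - x))\<^sup>2}"
    by (intro closed_Collect_le continuous_intros)
  ultimately have "W \<subseteq> {x. \<alpha> \<le> (norm (\<psi> j - x))\<^sup>2}"
    unfolding W_def by (intro closure_minimal) auto
  then have r0: "(norm r)\<^sup>2 \<noteq> 0" using p a0 by (auto simp: r_def)
  \<comment> \<open>Here \<open>\<psi> j\<close> is the sum of \<open>r\<close> and
    \<open>p\<close>, which are orthogonal; the value found is the factor to divide by.\<close>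
  have "ip r (\<psi> j) = ip r (r + p)" by (simp add: r_def)
  also have "\<dots> = of_real ((norm r)\<^sup>2)"
    using o[OF p] by (simp only: ip_add_right ip_self) (simp add: r_def)
  finally have rj: "ip r (\<psi> j) = of_real ((norm r)\<^sup>2)" .
  show thesis
  proof
    show "smul (inverse (of_real ((norm r)\<^sup>2))) r \<in> V"
      unfolding r_def using V \<psi> j p WV by (blast intro: subspace_scale subspace_diff)
    show "ip (smul (inverse (of_real ((norm r)\<^sup>2))) r) (\<psi> j) = 1"
      using r0 by (simp add: ip_smul_left rj)
    fix k assume "k \<in> J - {j}"
    then have "ip r (\<psi> k) = 0"
      unfolding r_def W_def using closure_subset
      by (intro o) (auto simp: W_def intro!: subsetD[OF closure_subset] span_base)
    then show "ip (smul (inverse (of_real ((norm r)\<^sup>2))) r) (\<psi> k) = 0"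
      by (simp add: ip_smul_left)
  qed
qed

section \<open>Frame bounds as Riesz bounds\<close>

lemma frame_synthesis_upper:
  assumes V: "subspace V" and \<psi>: "\<And>j. j \<in> J \<Longrightarrow> \<psi> j \<in> V"
    and fb: "frame_bounds ip V J \<psi> A B" and F: "finite F" "F \<subseteq> J"
  shows "(norm (\<Sum>j\<in>F. smul (c j) (\<psi> j)))\<^sup>2 \<le> B * (\<Sum>j\<in>F. (norm (c j))\<^sup>2)"
proof -
  define x where "x = (\<Sum>j\<in>F. smul (c j) (\<psi> j))"
  have xV: "x \<in> V" unfolding x_def
    using F \<psi> by (blast intro: subspace_sum[OF V] subspace_scale[OF V])
  then have sm: "(\<lambda>j. (norm (ip x (\<psi> j)))\<^sup>2) summable_on J"
    and B: "(\<Sum>\<^sub>\<infinity>j\<in>J. (norm (ip x (\<psi> j)))\<^sup>2) \<le> B * (norm x)\<^sup>2"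
    using fb by (auto simp: frame_bounds_def)
  \<comment> \<open>Pairing \<open>x\<close> with itself trades synthesis for the coefficients
    \<open>ip x (\<psi> j)\<close>, whose squares the upper frame bound controls; Cauchy-Schwarz for
    finite sums does the rest.\<close>
  have "(norm x)\<^sup>2 = norm (ip x x)"
    by (simp add: ip_self norm_power)
  also have "ip x x = (\<Sum>j\<in>F. c j * ip (\<psi> j) x)"
    by (subst x_def) (simp add: ip_sum_left ip_smul_left)
  also have "norm \<dots> \<le> (\<Sum>j\<in>F. norm (c j) * norm (ip x (\<psi> j)))"
    by (rule sum_norm_le) (simp add: norm_mult norm_ip_commute[of x])
  finally have "((norm x)\<^sup>2)\<^sup>2 \<le> (\<Sum>j\<in>F. norm (c j) * norm (ip x (\<psi> j)))\<^sup>2"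
    by (rule power_mono) simp
  also have "\<dots> \<le> (\<Sum>j\<in>F. (norm (c j))\<^sup>2) * (\<Sum>j\<in>F. (norm (ip x (\<psi> j)))\<^sup>2)"
    by (rule Cauchy_Schwarz_ineq_sum)
  also have "\<dots> \<le> (\<Sum>j\<in>F. (norm (c j))\<^sup>2) * (B * (norm x)\<^sup>2)"
    using finite_sum_le_infsum[OF sm F] B
    by (intro mult_left_mono) (auto intro: sum_nonneg)
  finally have "(norm x)\<^sup>2 * (norm x)\<^sup>2 \<le> (B * (\<Sum>j\<in>F. (norm (c j))\<^sup>2)) * (norm x)\<^sup>2"
    by (simp add: power2_eq_square ac_simps)
  moreover have "B > 0" using fb by (auto simp: frame_bounds_def)
  then have "B * (\<Sum>j\<in>F. (norm (c j))\<^sup>2) \<ge> 0" by (simp add: sum_nonneg)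
  \<comment> \<open>A factor of the squared norm of \<open>x\<close> cancels unless
    \<open>x = 0\<close>, where nonnegativity of the right side suffices.\<close>
  ultimately show ?thesis
    unfolding x_def[symmetric] by (cases "x = 0") (simp, metis mult_right_le_imp_le
        zero_less_norm_iff zero_less_power)
qed

text \<open>
  A finite coefficient family is the family of frame coefficients of a combination \<open>f\<close> of
  biorthogonal vectors, so the lower frame bound at \<open>f\<close> passes by duality to the synthesis operator.
\<close>

lemma frame_riesz_lower:
  assumes V: "subspace V" "closed V" and \<psi>: "\<And>j. j \<in> J \<Longrightarrow> \<psi> j \<in> V"
    and fb: "frame_bounds ip V J \<psi> A B" and rb: "riesz_bounds smul J \<psi> \<alpha> \<beta>"
    and F: "finite F" "F \<subseteq> J"
  shows "A * (\<Sum>j\<in>F. (norm (c j))\<^sup>2) \<le> (norm (\<Sum>j\<in>F. smul (c j) (\<psi> j)))\<^sup>2"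
proof -
  have "\<forall>j\<in>J. \<exists>g. g \<in> V \<and> ip g (\<psi> j) = 1 \<and> (\<forall>k\<in>J - {j}. ip g (\<psi> k) = 0)"
    using biorthogonal_vector[OF V \<psi> rb] by metis
  then obtain g where gV: "\<And>j. j \<in> J \<Longrightarrow> g j \<in> V"
    and g1: "\<And>j. j \<in> J \<Longrightarrow> ip (g j) (\<psi> j) = 1"
    and g0: "\<And>j k. j \<in> J \<Longrightarrow> k \<in> J \<Longrightarrow> k \<noteq> j \<Longrightarrow> ip (g j) (\<psi> k) = 0"
    by (metis Diff_iff singletonD)
  define s where "s = (\<Sum>j\<in>F. (norm (c j))\<^sup>2)"
  define x where "x = (\<Sum>j\<in>F. smul (c j) (\<psi> j))"
  define f where "f = (\<Sum>j\<in>F. smul (c j) (g j))"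
  have f: "ip f (\<psi> k) = (if k \<in> F then c k else 0)" if k: "k \<in> J" for k
  proof -
    have "ip f (\<psi> k) = (\<Sum>j\<in>F. if j = k then c k else 0)"
      unfolding f_def ip_sum_left ip_smul_left
      using F k g0 g1 by (intro sum.cong) auto
    then show ?thesis using F by simp
  qed
  have "(\<Sum>\<^sub>\<infinity>j\<in>J. (norm (ip f (\<psi> j)))\<^sup>2) = (\<Sum>\<^sub>\<infinity>j\<in>F. (norm (c j))\<^sup>2)"
    using F f by (intro infsum_cong_neutral) auto
  also have "\<dots> = s" using F by (simp add: s_def)
  finally have "(\<Sum>\<^sub>\<infinity>j\<in>J. (norm (ip f (\<psi> j)))\<^sup>2) = s" .
  moreover have "f \<in> V"
    unfolding f_def using F gV by (blast intro: subspace_sum[OF V(1)] subspace_scale[OF V(1)])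
  ultimately have Af: "A * (norm f)\<^sup>2 \<le> s" and A0: "A > 0"
    using fb by (auto simp: frame_bounds_def)
  \<comment> \<open>Pairing \<open>f\<close> with \<open>x\<close> gives exactly \<open>s\<close>,
    so Cauchy-Schwarz trades the upper bound \<open>Af\<close> on \<open>f\<close> for a lower bound
    on \<open>x\<close>.\<close>
  have "ip f x = (\<Sum>j\<in>F. c j * conjugate (c j))"
    unfolding x_def ip_sum_right ip_smul_right using F f by (intro sum.cong) auto
  also have "\<dots> = of_real s"
    by (simp add: mult_conjugate' s_def)
  finally have "s \<le> norm f * norm x"
    using Cauchy_Schwarz_ip[of f x] by simp
  moreover have s0: "s \<ge> 0" by (simp add: s_def sum_nonneg)
  ultimately have "s\<^sup>2 \<le> (norm f)\<^sup>2 * (norm x)\<^sup>2"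
    by (metis power_mono power_mult_distrib)
  then have "A * s\<^sup>2 \<le> A * (norm f)\<^sup>2 * (norm x)\<^sup>2"
    using A0 by (simp add: mult.assoc)
  also have "\<dots> \<le> s * (norm x)\<^sup>2"
    using Af by (rule mult_right_mono) simp
  finally have "(A * s) * s \<le> (norm x)\<^sup>2 * s" by (simp add: power2_eq_square ac_simps)
  then show ?thesis
    using s0 unfolding s_def[symmetric] x_def[symmetric] by (cases "s = 0") auto
qed

section \<open>Passage between the global frame and the local frames\<close>

lemma sum_global_frame_Sigma:
  assumes "finite F" "\<And>i. i \<in> F \<Longrightarrow> finite (G i)"
  shows "(\<Sum>p\<in>Sigma F G. smul (c p) (global_frame v \<phi> p)) =
           (\<Sum>i\<in>F. v i *\<^sub>R (\<Sum>j\<in>G i. smul (c (i, j)) (\<phi> i j)))"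
  using assms
  by (simp add: scaleR_sum_right sum.Sigma global_frame_def case_prod_unfold smul_scaleR)

text \<open>Dividing by the weight recovers each local vector from a global one; density of the
  local spans will thereby pass to the global frame.\<close>

lemma span_global_frame:
  assumes "\<And>i. i \<in> I \<Longrightarrow> v i \<noteq> 0" and i: "i \<in> I"
  shows "\<phi> i ` J i \<subseteq> span (global_frame v \<phi> ` Sigma I J)"
proof
  fix x assume "x \<in> \<phi> i ` J i"
  then obtain j where j: "j \<in> J i" "x = \<phi> i j" by blast
  then have "global_frame v \<phi> (i, j) \<in> span (global_frame v \<phi> ` Sigma I J)"
    using i by (auto intro!: span_base)
  then have "(1 / v i) *\<^sub>R global_frame v \<phi> (i, j) \<in> span (global_frame v \<phi> ` Sigma I J)"
    by (intro subspace_scaleR) auto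
  then show "x \<in> span (global_frame v \<phi> ` Sigma I J)"
    using assms j by (simp add: global_frame_def)
qed

text \<open>For coefficients supported over a single \<open>i\<close> the weight leaves the norm as
  a factor. The bounds obtained depend on \<open>i\<close>; they serve to establish the local Riesz
  property, after which \<open>A\<close> and \<open>B\<close> replace them.\<close>

lemma riesz_bounds_local:
  assumes rb: "riesz_bounds smul (Sigma I J) (global_frame v \<phi>) \<alpha> \<beta>"
    and i: "i \<in> I" and v: "v i > 0"
  shows "riesz_bounds smul (J i) (\<phi> i) (\<alpha> / (v i)\<^sup>2) (\<beta> / (v i)\<^sup>2)"
proof -
  have "\<alpha> * (\<Sum>j\<in>F. (norm (c j))\<^sup>2) \<le> (v i)\<^sup>2 * (norm (\<Sum>j\<in>F. smul (c j) (\<phi> i j)))\<^sup>2 \<and>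
        (v i)\<^sup>2 * (norm (\<Sum>j\<in>F. smul (c j) (\<phi> i j)))\<^sup>2 \<le> \<beta> * (\<Sum>j\<in>F. (norm (c j))\<^sup>2)"
    if F: "finite F" "F \<subseteq> J i" for F c
  proof -
    define P where "P = {i} \<times> F"
    have P: "finite P" "P \<subseteq> Sigma I J" using F i by (auto simp: P_def)
    have 1: "(\<Sum>p\<in>P. smul (c (snd p)) (global_frame v \<phi> p)) =
        v i *\<^sub>R (\<Sum>j\<in>F. smul (c j) (\<phi> i j))"
      unfolding P_def using F by (subst sum_global_frame_Sigma) auto
    have 2: "(\<Sum>p\<in>P. (norm (c (snd p)))\<^sup>2) = (\<Sum>j\<in>F. (norm (c j))\<^sup>2)"
      unfolding P_def
      by (rule sum.reindex_bij_witness[where i = "Pair i" and j = snd]) auto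
    have "\<alpha> * (\<Sum>p\<in>P. (norm (c (snd p)))\<^sup>2) \<le>
          (norm (\<Sum>p\<in>P. smul (c (snd p)) (global_frame v \<phi> p)))\<^sup>2 \<and>
        (norm (\<Sum>p\<in>P. smul (c (snd p)) (global_frame v \<phi> p)))\<^sup>2 \<le>
          \<beta> * (\<Sum>p\<in>P. (norm (c (snd p)))\<^sup>2)"
      by (intro conjI riesz_boundsD[OF rb P])
    then show ?thesis unfolding 1 2 by (simp add: power_mult_distrib)
  qed
  then show ?thesis
    using rb v by (auto simp: riesz_bounds_def field_simps)
qed

text \<open>Terms are grouped into blocks by \<open>i\<close>. The fusion bounds compare the whole
  sum with its blocks, the common local bounds compare each block with its coefficients, and the
  constants multiply.\<close>

lemma fusion_imp_global_riesz_bounds: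
  assumes A0: "A > 0" and AB: "A \<le> B"
    and sub: "\<And>i. i \<in> I \<Longrightarrow> subspace (V i)"
    and \<phi>: "\<And>i j. i \<in> I \<Longrightarrow> j \<in> J i \<Longrightarrow> \<phi> i j \<in> V i"
    and rb: "\<And>i. i \<in> I \<Longrightarrow> riesz_bounds smul (J i) (\<phi> i) A B"
    and frb: "fusion_riesz_bounds I V v \<alpha> \<beta>"
  shows "riesz_bounds smul (Sigma I J) (global_frame v \<phi>) (\<alpha> * A) (\<beta> * B)"
proof -
  have ab: "0 < \<alpha>" "\<alpha> \<le> \<beta>" using frb by (auto simp: fusion_riesz_bounds_def)
  have "\<alpha> * A * (\<Sum>p\<in>P. (norm (c p))\<^sup>2) \<le> (norm (\<Sum>p\<in>P. smul (c p) (global_frame v \<phi> p)))\<^sup>2 \<and>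
        (norm (\<Sum>p\<in>P. smul (c p) (global_frame v \<phi> p)))\<^sup>2 \<le> \<beta> * B * (\<Sum>p\<in>P. (norm (c p))\<^sup>2)"
    if P: "finite P" "P \<subseteq> Sigma I J" for P c
  proof -
    \<comment> \<open>A finite set of pairs need not be a product; splitting it into the fibres
      \<open>G i\<close> over its first coordinates makes it a \<open>Sigma\<close>.\<close>
    define F where "F = fst ` P"
    define G where "G i = Pair i -` P" for i
    have PS: "P = Sigma F G" by (force simp: F_def G_def)
    have F: "finite F" "F \<subseteq> I" using P by (auto simp: F_def)
    have G: "finite (G i)" "i \<in> I \<Longrightarrow> G i \<subseteq> J i" for i
      using P by (auto simp: G_def intro: finite_vimageI inj_onI)
    define f where "f i = (\<Sum>j\<in>G i. smul (c (i, j)) (\<phi> i j))" for i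
    define s where "s i = (\<Sum>j\<in>G i. (norm (c (i, j)))\<^sup>2)" for i
    have f: "f i \<in> V i" if "i \<in> F" for i
      unfolding f_def using that F G \<phi> sub
      by (intro subspace_sum subspace_scale) (meson subsetD)+
    have fs: "A * s i \<le> (norm (f i))\<^sup>2" "(norm (f i))\<^sup>2 \<le> B * s i" if "i \<in> F" for i
    proof -
      have i: "i \<in> I" using that F by blast
      show "A * s i \<le> (norm (f i))\<^sup>2" "(norm (f i))\<^sup>2 \<le> B * s i"
        unfolding f_def s_def by (rule riesz_boundsD[OF rb[OF i] G(1) G(2)[OF i]])+
    qed
    have 1: "(\<Sum>p\<in>P. smul (c p) (global_frame v \<phi> p)) = (\<Sum>i\<in>F. v i *\<^sub>R f i)"
      unfolding PS f_def by (rule sum_global_frame_Sigma[OF F(1) G(1)])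
    have 2: "(\<Sum>p\<in>P. (norm (c p))\<^sup>2) = (\<Sum>i\<in>F. s i)"
      unfolding PS s_def using F(1) G(1) by (simp add: sum.Sigma case_prod_unfold)
    have "\<alpha> * A * (\<Sum>i\<in>F. s i) \<le> \<alpha> * (\<Sum>i\<in>F. (norm (f i))\<^sup>2)"
      using ab fs by (simp add: mult.assoc sum_distrib_left sum_mono)
    moreover have "\<beta> * (\<Sum>i\<in>F. (norm (f i))\<^sup>2) \<le> \<beta> * B * (\<Sum>i\<in>F. s i)"
      using ab fs by (simp add: mult.assoc sum_distrib_left sum_mono)
    moreover have "\<alpha> * (\<Sum>i\<in>F. (norm (f i))\<^sup>2) \<le> (norm (\<Sum>i\<in>F. v i *\<^sub>R f i))\<^sup>2 \<and>
        (norm (\<Sum>i\<in>F. v i *\<^sub>R f i))\<^sup>2 \<le> \<beta> * (\<Sum>i\<in>F. (norm (f i))\<^sup>2)"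
      using frb F f unfolding fusion_riesz_bounds_def by blast
    ultimately show ?thesis unfolding 1 2 by linarith
  qed
  moreover have "\<alpha> * A \<le> \<beta> * B" using ab A0 AB by (intro mult_mono) auto
  ultimately show ?thesis
    unfolding riesz_bounds_def using ab A0 by auto
qed

text \<open>Blocks in the local spans combine to a finite combination of the global frame, so the
  global bounds apply to their coefficients. Density and continuity extend the inequalities to all
  of \<open>V i\<close>.\<close>

lemma global_imp_fusion_riesz_bounds:
  assumes A0: "A > 0" and AB: "A \<le> B"
    and dense: "\<And>i. i \<in> I \<Longrightarrow> closure (span (\<phi> i ` J i)) = V i"
    and rb: "\<And>i. i \<in> I \<Longrightarrow> riesz_bounds smul (J i) (\<phi> i) A B"
    and grb: "riesz_bounds smul (Sigma I J) (global_frame v \<phi>) \<alpha> \<beta>"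
  shows "fusion_riesz_bounds I V v (\<alpha> / B) (\<beta> / A)"
proof -
  have ab: "0 < \<alpha>" "\<alpha> \<le> \<beta>" using grb by (auto simp: riesz_bounds_def)
  have B0: "B > 0" using A0 AB by simp
  have span_case: "\<alpha> / B * (\<Sum>i\<in>F. (norm (f i))\<^sup>2) \<le> (norm (\<Sum>i\<in>F. v i *\<^sub>R f i))\<^sup>2 \<and>
        (norm (\<Sum>i\<in>F. v i *\<^sub>R f i))\<^sup>2 \<le> \<beta> / A * (\<Sum>i\<in>F. (norm (f i))\<^sup>2)"
    if F: "finite F" "F \<subseteq> I" and f: "\<And>i. i \<in> F \<Longrightarrow> f i \<in> span (\<phi> i ` J i)" for F f
  proof -
    have "\<forall>i\<in>F. \<exists>G c. finite G \<and> G \<subseteq> J i \<and> f i = (\<Sum>j\<in>G. smul (c j) (\<phi> i j))"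
      using span_image_explicit[OF f] by metis
    then obtain G c where G: "\<And>i. i \<in> F \<Longrightarrow> finite (G i)" "\<And>i. i \<in> F \<Longrightarrow> G i \<subseteq> J i"
      and fG: "\<And>i. i \<in> F \<Longrightarrow> f i = (\<Sum>j\<in>G i. smul (c i j) (\<phi> i j))"
      by metis
    define s where "s i = (\<Sum>j\<in>G i. (norm (c i j))\<^sup>2)" for i
    have fs: "A * s i \<le> (norm (f i))\<^sup>2" "(norm (f i))\<^sup>2 \<le> B * s i" if "i \<in> F" for i
      using rb[of i] that F G[of i] unfolding riesz_bounds_def s_def fG[OF that] by blast+
    have P: "finite (Sigma F G)" "Sigma F G \<subseteq> Sigma I J" using F G by (auto dest: subsetD)
    have 1: "(\<Sum>p\<in>Sigma F G. smul (case_prod c p) (global_frame v \<phi> p)) = (\<Sum>i\<in>F. v i *\<^sub>R f i)"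
      using F G fG by (subst sum_global_frame_Sigma) auto
    have 2: "(\<Sum>p\<in>Sigma F G. (norm (case_prod c p))\<^sup>2) = (\<Sum>i\<in>F. s i)"
      unfolding s_def using F G by (subst sum.Sigma) (auto intro!: sum.cong)
    have "\<alpha> * (\<Sum>p\<in>Sigma F G. (norm (case_prod c p))\<^sup>2) \<le>
        (norm (\<Sum>p\<in>Sigma F G. smul (case_prod c p) (global_frame v \<phi> p)))\<^sup>2 \<and>
        (norm (\<Sum>p\<in>Sigma F G. smul (case_prod c p) (global_frame v \<phi> p)))\<^sup>2 \<le>
        \<beta> * (\<Sum>p\<in>Sigma F G. (norm (case_prod c p))\<^sup>2)"
      using grb P unfolding riesz_bounds_def by blast
    then have "\<alpha> * (\<Sum>i\<in>F. s i) \<le> (norm (\<Sum>i\<in>F. v i *\<^sub>R f i))\<^sup>2"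
      "(norm (\<Sum>i\<in>F. v i *\<^sub>R f i))\<^sup>2 \<le> \<beta> * (\<Sum>i\<in>F. s i)"
      unfolding 1 2 by auto
    \<comment> \<open>The lower estimate needs coefficients that are large relative to the blocks,
      hence the upper local bound \<open>B\<close>; the upper estimate needs \<open>A\<close> for
      the opposite reason.\<close>
    moreover have "\<alpha> / B * (\<Sum>i\<in>F. (norm (f i))\<^sup>2) \<le> \<alpha> * (\<Sum>i\<in>F. s i)"
      unfolding sum_distrib_left using ab B0 fs by (intro sum_mono) (simp add: field_simps)
    moreover have "\<beta> * (\<Sum>i\<in>F. s i) \<le> \<beta> / A * (\<Sum>i\<in>F. (norm (f i))\<^sup>2)"
      unfolding sum_distrib_left using ab A0 fs by (intro sum_mono) (simp add: field_simps)
    ultimately show ?thesis by linarith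
  qed
  have "\<alpha> / B * (\<Sum>i\<in>F. (norm (f i))\<^sup>2) \<le> (norm (\<Sum>i\<in>F. v i *\<^sub>R f i))\<^sup>2 \<and>
        (norm (\<Sum>i\<in>F. v i *\<^sub>R f i))\<^sup>2 \<le> \<beta> / A * (\<Sum>i\<in>F. (norm (f i))\<^sup>2)"
    if F: "finite F" "F \<subseteq> I" and f: "\<And>i. i \<in> F \<Longrightarrow> f i \<in> V i" for F f
  proof -
    \<comment> \<open>Each block gets its own approximating sequence. As \<open>F\<close> is finite,
      both sides converge and the non-strict inequalities survive.\<close>
    have "\<forall>i\<in>F. \<exists>s. (\<forall>n. s n \<in> span (\<phi> i ` J i)) \<and> s \<longlonglongrightarrow> f i"
      using f F dense closure_sequential by (metis subsetD)
    then obtain s where s: "\<And>i n. i \<in> F \<Longrightarrow> s i n \<in> span (\<phi> i ` J i)"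
      and lim: "\<And>i. i \<in> F \<Longrightarrow> s i \<longlonglongrightarrow> f i"
      by metis
    have l1: "(\<lambda>n. (norm (\<Sum>i\<in>F. v i *\<^sub>R s i n))\<^sup>2) \<longlonglongrightarrow> (norm (\<Sum>i\<in>F. v i *\<^sub>R f i))\<^sup>2"
      by (intro tendsto_intros lim)
    have l2: "(\<lambda>n. r * (\<Sum>i\<in>F. (norm (s i n))\<^sup>2)) \<longlonglongrightarrow> r * (\<Sum>i\<in>F. (norm (f i))\<^sup>2)" for r
      by (intro tendsto_intros lim)
    show ?thesis
      using span_case[OF F, of "\<lambda>i. s i _"] s
      by (intro conjI LIMSEQ_le[OF l1 l2] LIMSEQ_le[OF l2 l1]) blast+
  qed
  moreover have "\<alpha> / B \<le> \<beta> / A" using ab A0 AB by (intro frac_le) auto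
  ultimately show ?thesis
    unfolding fusion_riesz_bounds_def using ab B0 by auto
qed

end

section \<open>The equivalence and the transfer of bounds\<close>

theorem theorem4p8:
  fixes smul :: "'k::rc_field \<Rightarrow> 'a::banach \<Rightarrow> 'a"
    and ip :: "'a \<Rightarrow> 'a \<Rightarrow> 'k"
    and I :: "'i set" and V :: "'i \<Rightarrow> 'a set" and v :: "'i \<Rightarrow> real"
    and J :: "'i \<Rightarrow> 'j set" and \<phi> :: "'i \<Rightarrow> 'j \<Rightarrow> 'a"
    and A B :: real
  assumes "hilbert_space smul ip"
    and "fusion_frame_system smul ip I V v J \<phi>"
    and "common_frame_bounds ip I V J \<phi> A B"
  shows "(riesz_basis smul UNIV (Sigma I J) (global_frame v \<phi>) \<longleftrightarrow>
            fusion_riesz_basis smul I V v \<and> (\<forall>i\<in>I. riesz_basis smul (V i) (J i) (\<phi> i))) \<and>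
         (riesz_basis smul UNIV (Sigma I J) (global_frame v \<phi>) \<longrightarrow>
            (\<forall>\<alpha> \<beta>. fusion_riesz_bounds I V v \<alpha> \<beta> \<longrightarrow>
               riesz_bounds smul (Sigma I J) (global_frame v \<phi>) (\<alpha> * A) (\<beta> * B)) \<and>
            (\<forall>\<alpha> \<beta>. riesz_bounds smul (Sigma I J) (global_frame v \<phi>) \<alpha> \<beta> \<longrightarrow>
               fusion_riesz_bounds I V v (\<alpha> / B) (\<beta> / A)))"
proof -
  interpret hilbert_space smul ip by (rule assms)
  have ws: "weighted_subspaces smul I V v"
    using assms by (simp add: fusion_frame_system_def fusion_frame_def)
  then have sub: "subspace (V i)" and cl: "closed (V i)" and v: "v i > 0" if "i \<in> I" for i
    using that by (auto simp: weighted_subspaces_def)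
  have \<phi>: "\<phi> i j \<in> V i" if "i \<in> I" "j \<in> J i" for i j
    using assms that by (auto simp: fusion_frame_system_def frame_def)
  have A0: "A > 0" and AB: "A \<le> B"
    and fb: "\<And>i. i \<in> I \<Longrightarrow> frame_bounds ip (V i) (J i) (\<phi> i) A B"
    using assms by (auto simp: common_frame_bounds_def)
  have dense: "closure (span (\<phi> i ` J i)) = V i" if "i \<in> I" for i
    using that by (intro frame_span_dense[OF sub cl \<phi> fb])
  \<comment> \<open>Whatever Riesz bounds a local frame has, the common frame bounds may replace
    them, which makes the local bounds uniform in \<open>i\<close>.\<close>
  have rbAB: "riesz_bounds smul (J i) (\<phi> i) A B"
    if "i \<in> I" "riesz_bounds smul (J i) (\<phi> i) \<alpha> \<beta>" for i \<alpha> \<beta>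
    using frame_riesz_lower[OF sub cl \<phi> fb that(2)] frame_synthesis_upper[OF sub \<phi> fb] that(1) A0 AB
    by (auto simp: riesz_bounds_def)
  define g where "g = global_frame v \<phi>"
  have local: "riesz_bounds smul (J i) (\<phi> i) A B"
    if "riesz_basis smul UNIV (Sigma I J) g" "i \<in> I" for i
    using that riesz_bounds_local[of I J v \<phi>] v rbAB unfolding riesz_basis_def g_def by meson
  have fwd: "fusion_riesz_bounds I V v (\<alpha> / B) (\<beta> / A)"
    if "riesz_basis smul UNIV (Sigma I J) g" "riesz_bounds smul (Sigma I J) g \<alpha> \<beta>" for \<alpha> \<beta>
    by (rule global_imp_fusion_riesz_bounds[OF A0 AB])
      (use dense local[OF that(1)] that(2) in \<open>auto simp: g_def\<close>)
  have bwd: "riesz_bounds smul (Sigma I J) g (\<alpha> * A) (\<beta> * B)"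
    if "\<And>i. i \<in> I \<Longrightarrow> riesz_bounds smul (J i) (\<phi> i) A B" "fusion_riesz_bounds I V v \<alpha> \<beta>" for \<alpha> \<beta>
    unfolding g_def by (rule fusion_imp_global_riesz_bounds[OF A0 AB]) (use sub \<phi> that in auto)
  have "fusion_riesz_basis smul I V v \<and> (\<forall>i\<in>I. riesz_basis smul (V i) (J i) (\<phi> i))"
    if g: "riesz_basis smul UNIV (Sigma I J) g"
  proof (intro conjI ballI)
    \<comment> \<open>Each global vector is a multiple of a local one, so the span of the subspaces
      contains the global span, which is already dense.\<close>
    have "g p \<in> span (\<Union>i\<in>I. V i)" if "p \<in> Sigma I J" for p
    proof -
      obtain i j where p: "p = (i, j)" "i \<in> I" "j \<in> J i" using \<open>p \<in> Sigma I J\<close> by blast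
      then have "g p \<in> V i"
        using subspace_scaleR[OF sub \<phi>] by (simp add: g_def global_frame_def)
      then show ?thesis using p by (blast intro: span_base)
    qed
    then have "span (g ` Sigma I J) \<subseteq> span (\<Union>i\<in>I. V i)"
      by (intro span_minimal) auto
    then have "closure (span (\<Union>i\<in>I. V i)) = UNIV"
      using g closure_mono unfolding riesz_basis_def by blast
    then show "fusion_riesz_basis smul I V v"
      using ws fwd[OF g] g unfolding fusion_riesz_basis_def riesz_basis_def by blast
    show "riesz_basis smul (V i) (J i) (\<phi> i)" if "i \<in> I" for i
      using that dense local[OF g] unfolding riesz_basis_def by blast
  qed
  moreover have "riesz_basis smul UNIV (Sigma I J) g"
    if f: "fusion_riesz_basis smul I V v" and l: "\<forall>i\<in>I. riesz_basis smul (V i) (J i) (\<phi> i)"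
  proof -
    have "riesz_bounds smul (J i) (\<phi> i) A B" if "i \<in> I" for i
      using l that rbAB unfolding riesz_basis_def by meson
    then have "\<exists>\<alpha> \<beta>. riesz_bounds smul (Sigma I J) g \<alpha> \<beta>"
      using bwd f unfolding fusion_riesz_basis_def by meson
    \<comment> \<open>Completeness passes back because \<open>V i\<close> is the closure of its
      local span, and the global span contains that span.\<close>
    moreover have "V i \<subseteq> closure (span (g ` Sigma I J))" if "i \<in> I" for i
    proof -
      have "\<phi> i ` J i \<subseteq> span (g ` Sigma I J)"
        unfolding g_def using span_global_frame[of I v i \<phi> J] v that by force
      then have "closure (span (\<phi> i ` J i)) \<subseteq> closure (span (g ` Sigma I J))"
        by (intro closure_mono span_minimal) auto
      then show ?thesis using dense[OF that] by simp
    qed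
    then have "closure (span (\<Union>i\<in>I. V i)) \<subseteq> closure (span (g ` Sigma I J))"
      by (intro closure_span_subset subspace_closure) auto
    then have "closure (span (g ` Sigma I J)) = UNIV"
      using f unfolding fusion_riesz_basis_def by auto
    ultimately show ?thesis unfolding riesz_basis_def by blast
  qed
  \<comment> \<open>\<open>bwd\<close> asks for the local bounds \<open>A\<close> and
    \<open>B\<close>; in the claim on bounds, \<open>local\<close> supplies them from the Riesz
    property of the global frame.\<close>
  ultimately show ?thesis
    using local fwd bwd unfolding g_def[symmetric] by blast
qed

end
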